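(* Let $\mathbb{I}_6$ be the minimal, $6$-vertex triangulation of the real projective plane $\mathbb{R}P^2$ (the hemi-icosahedron). Then the Bier sphere $Bier(\mathbb{I}_6)$ is polytopal, i.e. it can be realized as the boundary sphere of a five-dimensional convex polytope. More explicitly, the vertices of such a geometric realization are given by the twelve rows of the following matrix, i.e. the convex hull in $\mathbb{R}^5$ of these rows is a five-dimensional simplicial polytope whose vertices are exactly the twelve rows and whose boundary complex is isomorphic, as a simplicial complex, to $Bier(\mathbb{I}_6)$: $$ \left[ \begin{array}{ccccc} 3.4083657 & 2.5824889 & 2.7636015 & 4.2308106 & 1.8312304\\ 4.7537197 & 5.7195211 & 4.3242208 & 5.0848353 & 4.7010916\\ -3.6225148 & -3.6600717 & -2.256866 & -3.0205762 & -3.2792018\\ -0.5413665 & -1.3194438 & 0.1968267 & 2.6400609 & -2.4040568\\ 1.200048 & 2.0558616 & 0.1089153 & -2.0769712 & 4.0182034\\ -3.8440022 & -3.7596347 & -4.3286914 & -6.2082317 & -2.9269678\\ -2.018964 & -0.6272048 & -0.8564941 & -2.3165986 & -0.1697324\\ -4.3439331 & -4.8032114 & -3.0078281 & -3.1808993 & -4.0042503\\ -1.5662252 & -1.3174413 & -2.9671459 & -4.6607583 & -0.1247618\\ 0.1168746 & -0.1838719 & -0.1546464 & -1.6760483 & 0.2340882\\ 1.232693 & 0.4628524 & 1.7251772 & 4.4773757 & -1.512764\\ 5.2253047 & 4.8501556 & 4.4529303 & 6.7070012 & 3.6371211 \end{array} \right] $$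
   Context: Let $[n]=\{1,\dots,n\}$. For a simplicial complex $K\subsetneq 2^{[n]}$, its Alexander dual is $K^\circ=\{A\subset[n] \mid [n]\setminus A\notin K\}$. The Bier sphere $Bier(K)=K\ast_\Delta K^\circ$ is the deleted join of $K$ and $K^\circ$: it is the simplicial complex on the vertices $1,\dots,n,\bar 1,\dots,\bar n$ whose faces are the sets $A\cup\{\bar j \mid j\in B\}$ with $A\in K$, $B\in K^\circ$ and $A\cap B=\emptyset$. The hemi-icosahedron $\mathbb{I}_6$ is the $\mathbb{Z}_2$-quotient (by the antipodal map) of the boundary complex of the icosahedron; it is the vertex-minimal triangulation of $\mathbb{R}P^2$, unique up to relabeling of vertices. Explicitly, up to relabeling, it is the simplicial complex on $\{1,2,3,4,5,6\}$ whose maximal faces are the ten triangles $123, 126, 135, 145, 146, 234, 245, 256, 346, 356$. *)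

theory Defs
  imports "HOL-Analysis.Analysis"
begin

text \<open>
  An abstract simplicial complex is represented by its set of faces, the empty face included.
\<close>

definition simplicial_complex_generated_by :: "'a set set \<Rightarrow> 'a set set" where
  "simplicial_complex_generated_by F = (\<Union>S\<in>F. Pow S)"

definition simplicial_complex_isomorphic :: "'a set set \<Rightarrow> 'b set set \<Rightarrow> bool" where
  "simplicial_complex_isomorphic K L \<longleftrightarrow>
     (\<exists>f. bij_betw f (\<Union>K) (\<Union>L) \<and> (\<forall>A. A \<subseteq> \<Union>K \<longrightarrow> (A \<in> K \<longleftrightarrow> f ` A \<in> L)))"

definition alexander_dual :: "nat \<Rightarrow> nat set set \<Rightarrow> nat set set" where
  "alexander_dual n K = {A. A \<subseteq> {1..n} \<and> {1..n} - A \<notin> K}"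

text \<open>
  In the deleted join the vertex \<open>i\<close> of the first complex becomes \<open>Inl i\<close>, and the vertex
  \<open>j\<close> of the second complex (written with a bar in the literature) becomes \<open>Inr j\<close>.
\<close>

definition deleted_join :: "'a set set \<Rightarrow> 'a set set \<Rightarrow> ('a + 'a) set set" where
  "deleted_join K L = {A <+> B | A B. A \<in> K \<and> B \<in> L \<and> A \<inter> B = {}}"

definition Bier :: "nat \<Rightarrow> nat set set \<Rightarrow> (nat + nat) set set" where
  "Bier n K = deleted_join K (alexander_dual n K)"

definition hemi_icosahedron :: "nat set set" where
  "hemi_icosahedron = simplicial_complex_generated_by
     {{1,2,3}, {1,2,6}, {1,3,5}, {1,4,5}, {1,4,6},
      {2,3,4}, {2,4,5}, {2,5,6}, {3,4,6}, {3,5,6}}"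

definition vertices_of :: "'a::euclidean_space set \<Rightarrow> 'a set" where
  "vertices_of P = {x. x extreme_point_of P}"

definition simplicial_polytope :: "'a::euclidean_space set \<Rightarrow> bool" where
  "simplicial_polytope P \<longleftrightarrow>
     polytope P \<and> (\<forall>F. F face_of P \<and> F \<noteq> P \<longrightarrow> (\<exists>k. k simplex F))"

text \<open>
  Each proper face of the polytope is recorded by its set of vertices; the empty set is a
  face in the sense of \<^const>\<open>face_of\<close> and gives the empty face of the complex.
\<close>

definition boundary_complex :: "'a::euclidean_space set \<Rightarrow> 'a set set" where
  "boundary_complex P = {vertices_of F | F. F face_of P \<and> F \<noteq> P}"

definition bier_matrix :: "real ^ 5 ^ 12" where
  "bier_matrix = vector
    [vector [ 3.4083657,  2.5824889,  2.7636015,  4.2308106,  1.8312304],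
     vector [ 4.7537197,  5.7195211,  4.3242208,  5.0848353,  4.7010916],
     vector [-3.6225148, -3.6600717, -2.256866,  -3.0205762, -3.2792018],
     vector [-0.5413665, -1.3194438,  0.1968267,  2.6400609, -2.4040568],
     vector [ 1.200048,   2.0558616,  0.1089153, -2.0769712,  4.0182034],
     vector [-3.8440022, -3.7596347, -4.3286914, -6.2082317, -2.9269678],
     vector [-2.018964,  -0.6272048, -0.8564941, -2.3165986, -0.1697324],
     vector [-4.3439331, -4.8032114, -3.0078281, -3.1808993, -4.0042503],
     vector [-1.5662252, -1.3174413, -2.9671459, -4.6607583, -0.1247618],
     vector [ 0.1168746, -0.1838719, -0.1546464, -1.6760483,  0.2340882],
     vector [ 1.232693,   0.4628524,  1.7251772,  4.4773757, -1.512764],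
     vector [ 5.2253047,  4.8501556,  4.4529303,  6.7070012,  3.6371211]]"

end

theory Submission
  imports Defs
begin

text \<open>
  The vertex \<open>i\<close> corresponds to row \<open>i\<close> of the matrix and the barred vertex \<open>i\<close> to row \<open>6 + i\<close>.
  That a simplicial complex on points \<open>v i\<close> is the boundary complex of their convex hull can be
  certified from two sides.  For every facet there is an affine functional that vanishes on it and
  is positive at all other points; since distinct facets sharing a ridge are separated in this way,
  the facets are affinely independent, so all simplices of the complex are faces of the hull.
  For every minimal nonface \<open>N\<close> there is an affine dependence of the points whose
  coefficients off \<open>N\<close> are positive; a functional that is maximal on \<open>N\<close> must then be
  constant, so no proper face contains \<open>N\<close>.  The complex \<open>Bier(I_6)\<close> has 60 facets and, as
  \<open>I_6\<close> is its own Alexander dual, only 26 minimal nonfaces, and both families of certificates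
  are verified in exact integer arithmetic.
\<close>

section \<open>Certifying the boundary complex of a simplicial polytope\<close>

text \<open>\<open>supporting\<close> separates a face from one outside vertex at a time, so the
  functional of any facet that contains the face and misses this vertex can serve.
  \<open>dependence\<close> prescribes no signs on \<open>S\<close>, so a dependence for a minimal
  nonface serves every nonface containing it.\<close>

locale simplicial_certificate =
  fixes v :: "'i \<Rightarrow> 'a::euclidean_space" and I :: "'i set" and K :: "'i set set"
  assumes finite_index: "finite I"
    and face_subset: "A \<in> K \<Longrightarrow> A \<subseteq> I"
    and face_closed: "A \<in> K \<Longrightarrow> B \<subseteq> A \<Longrightarrow> B \<in> K"
    and vertex_face: "i \<in> I \<Longrightarrow> {i} \<in> K"
    and index_not_face: "I \<notin> K"
    and supporting: "A \<in> K \<Longrightarrow> i \<in> I - A \<Longrightarrow>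
      \<exists>a b. (\<forall>j\<in>I. b \<le> a \<bullet> v j) \<and> (\<forall>j\<in>A. a \<bullet> v j = b) \<and> b < a \<bullet> v i"
    and dependence: "S \<subseteq> I \<Longrightarrow> S \<notin> K \<Longrightarrow>
      \<exists>c. (\<Sum>i\<in>I. c i *\<^sub>R v i) = 0 \<and> (\<Sum>i\<in>I. c i) = (0::real) \<and> (\<forall>i\<in>I - S. 0 < c i)"
begin

definition P :: "'a set" where "P = convex hull (v ` I)"

lemma polytope_P: "polytope P"
  unfolding P_def polytope_def using finite_index by blast

lemma vertex_in_P: "i \<in> I \<Longrightarrow> v i \<in> P"
  unfolding P_def by (simp add: hull_inc)

lemma proper_index:
  assumes "A \<in> K"
  obtains i where "i \<in> I - A"
proof -
  have "A \<subset> I" using face_subset[OF assms] index_not_face assms by auto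
  then show ?thesis using that by blast
qed

text \<open>The functional from \<open>supporting\<close> is constant on \<open>A\<close>, hence on
  its affine hull, but strictly larger at the outside point.\<close>

lemma not_in_affine_hull:
  assumes "A \<in> K" "i \<in> I - A"
  shows "v i \<notin> affine hull (v ` A)"
proof
  assume v: "v i \<in> affine hull (v ` A)"
  obtain a b where "\<forall>j\<in>A. a \<bullet> v j = b" and b: "b < a \<bullet> v i"
    using supporting[OF assms] by blast
  then have "affine hull (v ` A) \<subseteq> {x. a \<bullet> x = b}"
    by (intro hull_minimal affine_hyperplane) auto
  then show False using v b by auto
qed

text \<open>A singleton face spans only its own point, which every other vertex has to
  avoid.\<close>

lemma inj_on_index: "inj_on v I"
proof (rule inj_onI, rule ccontr)
  fix i j assume "i \<in> I" "j \<in> I" "v i = v j" "i \<noteq> j"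
  then show False using not_in_affine_hull[of "{j}" i] vertex_face by simp
qed

text \<open>Removing a vertex from a face leaves a face, and the removed vertex avoids its affine
  hull.\<close>

lemma affine_independent:
  assumes "A \<in> K"
  shows "\<not> affine_dependent (v ` A)"
proof
  assume "affine_dependent (v ` A)"
  then obtain i where i: "i \<in> A" "v i \<in> affine hull (v ` A - {v i})"
    unfolding affine_dependent_def by blast
  have "v ` A - {v i} = v ` (A - {i})"
    using inj_on_image_set_diff[OF inj_on_index, of A "{i}"] i(1) face_subset[OF assms] by auto
  moreover have "v i \<notin> affine hull (v ` (A - {i}))"
    by (rule not_in_affine_hull) (use i(1) assms face_closed face_subset in blast)+
  ultimately show False using i(2) by simp
qed

lemma proper_subset_P:
  assumes "A \<in> K"
  shows "convex hull (v ` A) \<noteq> P"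
proof -
  obtain i where i: "i \<in> I - A"
    using proper_index[OF assms] by blast
  then have "v i \<notin> convex hull (v ` A)"
    using not_in_affine_hull[OF assms i] convex_hull_subset_affine_hull by blast
  then show ?thesis using i vertex_in_P by blast
qed

text \<open>For each outside index a supporting hyperplane cuts out a face through \<open>A\<close>
  that misses this vertex. The intersection of these faces is a face spanned by some of the points
  \<open>v i\<close>, and only those with \<open>i\<close> in \<open>A\<close> are left.\<close>

lemma hull_face_of_P:
  assumes "A \<in> K"
  shows "convex hull (v ` A) face_of P"
proof -
  have "\<forall>i\<in>I - A. \<exists>G. G face_of P \<and> v ` A \<subseteq> G \<and> v i \<notin> G"
  proof
    fix i assume i: "i \<in> I - A"
    obtain a b where ab: "\<forall>j\<in>I. b \<le> a \<bullet> v j" "\<forall>j\<in>A. a \<bullet> v j = b" "b < a \<bullet> v i"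
      using supporting[OF assms i] by blast
    have "P \<subseteq> {x. a \<bullet> x \<ge> b}"
      unfolding P_def using ab(1) by (intro hull_minimal convex_halfspace_ge) auto
    then have "(P \<inter> {x. a \<bullet> x = b}) face_of P"
      by (intro face_of_Int_supporting_hyperplane_ge) (auto simp: P_def)
    moreover have "v ` A \<subseteq> P \<inter> {x. a \<bullet> x = b}"
      using ab(2) face_subset[OF assms] vertex_in_P by auto
    moreover have "v i \<notin> P \<inter> {x. a \<bullet> x = b}" using ab(3) by simp
    ultimately show "\<exists>G. G face_of P \<and> v ` A \<subseteq> G \<and> v i \<notin> G" by blast
  qed
  then obtain G where G: "\<And>i. i \<in> I - A \<Longrightarrow> G i face_of P \<and> v ` A \<subseteq> G i \<and> v i \<notin> G i"
    by metis
  define F where "F = (\<Inter>i\<in>I - A. G i)"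
  \<comment> \<open>An intersection over no index at all would be the whole space.\<close>
  have "I - A \<noteq> {}" using proper_index[OF assms] by blast
  then have F: "F face_of P"
    unfolding F_def using G by (intro face_of_Inter) auto
  obtain S where S: "S \<subseteq> v ` I" "F = convex hull S"
    using face_of_convex_hull_subset[of "v ` I" F] F finite_index
    by (auto simp: P_def finite_imp_compact)
  have "S \<subseteq> v ` A"
  proof
    fix x assume x: "x \<in> S"
    then obtain i where i: "i \<in> I" "x = v i" using S(1) by blast
    have "x \<in> F" using x S(2) by (simp add: hull_inc)
    then show "x \<in> v ` A" using i G unfolding F_def by blast
  qed
  then have "F \<subseteq> convex hull (v ` A)" using S(2) hull_mono by blast
  moreover have "v ` A \<subseteq> F" unfolding F_def using G by blast
  then have "convex hull (v ` A) \<subseteq> F"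
    using F face_of_imp_convex hull_minimal by blast
  ultimately show ?thesis using F by simp
qed

text \<open>Let \<open>A\<close> collect all vertices in \<open>F\<close>. If it were a nonface, the
  dependence would have positive coefficients wherever the inequality defining \<open>F\<close> can
  be strict; this forces equality at every vertex, and \<open>F\<close> would be all of
  \<open>P\<close>.\<close>

lemma proper_face_is_hull:
  assumes "F face_of P" "F \<noteq> P"
  shows "\<exists>A\<in>K. F = convex hull (v ` A)"
proof -
  define A where "A = {i \<in> I. v i \<in> F}"
  obtain S where S: "S \<subseteq> v ` I" "F = convex hull S"
    using face_of_convex_hull_subset[of "v ` I" F] assms finite_index
    by (auto simp: P_def finite_imp_compact)
  have "S \<subseteq> v ` A" using S hull_subset[of S convex] unfolding A_def by blast
  then have "F \<subseteq> convex hull (v ` A)" using S(2) hull_mono by blast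
  moreover have "convex hull (v ` A) \<subseteq> F"
    unfolding A_def using assms(1) face_of_imp_convex by (intro hull_minimal) auto
  ultimately have F: "F = convex hull (v ` A)" by simp
  have "A \<in> K"
  proof (rule ccontr)
    assume "A \<notin> K"
    then obtain c where c: "(\<Sum>i\<in>I. c i *\<^sub>R v i) = 0" "(\<Sum>i\<in>I. c i) = 0" "\<forall>i\<in>I - A. 0 < c i"
      using dependence[of A] unfolding A_def by blast
    \<comment> \<open>All faces of a polytope are exposed, so \<open>F\<close> is the locus where
      one inequality valid on \<open>P\<close> is tight.\<close>
    have "F exposed_face_of P"
      using assms(1) polytope_P by (simp add: exposed_face_of_polyhedron polytope_imp_polyhedron)
    then obtain a b where ab: "P \<subseteq> {x. a \<bullet> x \<le> b}" "F = P \<inter> {x. a \<bullet> x = b}"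
      unfolding exposed_face_of_def by blast
    \<comment> \<open>The slack \<open>b - a \<bullet> v i\<close> is affine in \<open>v i\<close>,
      so an affine dependence annihilates the weighted sum of the slacks.\<close>
    have "(\<Sum>i\<in>I. c i * (b - a \<bullet> v i)) = b * (\<Sum>i\<in>I. c i) - a \<bullet> (\<Sum>i\<in>I. c i *\<^sub>R v i)"
      by (simp add: inner_sum_right sum_distrib_left sum_subtractf algebra_simps)
    then have sum0: "(\<Sum>i\<in>I. c i * (b - a \<bullet> v i)) = 0" using c by simp
    \<comment> \<open>For \<open>i\<close> in \<open>A\<close> the sign of \<open>c i\<close> is
      unknown, but there the slack is zero.\<close>
    have nonneg: "0 \<le> c i * (b - a \<bullet> v i)" if "i \<in> I" for i
    proof (cases "i \<in> A")
      case True
      then show ?thesis using ab(2) by (simp add: A_def)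
    next
      case False
      then have "0 < c i" "a \<bullet> v i \<le> b"
        using c(3) ab(1) vertex_in_P[OF that] that by auto
      then show ?thesis by simp
    qed
    have zero: "c i * (b - a \<bullet> v i) = 0" if "i \<in> I" for i
      using sum_nonneg_0[OF finite_index nonneg sum0 that] by simp
    have "v i \<in> F" if "i \<in> I" for i
    proof (cases "i \<in> A")
      case False
      then have "0 < c i" using c(3) that by blast
      then have "a \<bullet> v i = b" using zero[OF that] by simp
      then show ?thesis using ab(2) vertex_in_P[OF that] by simp
    qed (simp add: A_def)
    then have "P \<subseteq> F"
      unfolding P_def using assms(1) face_of_imp_convex by (intro hull_minimal) auto
    then show False using assms face_of_imp_subset by blast
  qed
  then show ?thesis using F by blast
qed

lemma vertices_of_hull: "A \<in> K \<Longrightarrow> vertices_of (convex hull (v ` A)) = v ` A"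
  unfolding vertices_of_def
  using extreme_point_of_convex_hull_affine_independent[OF affine_independent] by blast

text \<open>Singletons belong to \<open>K\<close>, so each \<open>v i\<close> is a one-point face
  and hence extreme.\<close>

lemma vertices_of_P: "vertices_of P = v ` I"
proof
  show "vertices_of P \<subseteq> v ` I"
    unfolding vertices_of_def P_def using extreme_point_of_convex_hull by blast
  show "v ` I \<subseteq> vertices_of P"
    unfolding vertices_of_def
    using hull_face_of_P[OF vertex_face] by (auto simp: face_of_singleton)
qed

lemma boundary_complex_P: "boundary_complex P = (`) v ` K"
proof
  show "boundary_complex P \<subseteq> (`) v ` K"
  proof
    fix X assume "X \<in> boundary_complex P"
    then obtain F where F: "F face_of P" "F \<noteq> P" "X = vertices_of F"
      unfolding boundary_complex_def by blast
    then obtain A where "A \<in> K" "F = convex hull (v ` A)"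
      using proper_face_is_hull by blast
    then show "X \<in> (`) v ` K" using F(3) vertices_of_hull by blast
  qed
  show "(`) v ` K \<subseteq> boundary_complex P"
  proof
    fix X assume "X \<in> (`) v ` K"
    then obtain A where "A \<in> K" "X = v ` A" by blast
    then show "X \<in> boundary_complex P"
      unfolding boundary_complex_def
      using hull_face_of_P proper_subset_P vertices_of_hull
      by (auto intro!: exI[of _ "convex hull (v ` A)"])
  qed
qed

lemma simplicial_P: "simplicial_polytope P"
  unfolding simplicial_polytope_def
proof (intro conjI polytope_P allI impI)
  fix F assume "F face_of P \<and> F \<noteq> P"
  then obtain A where A: "A \<in> K" "F = convex hull (v ` A)"
    using proper_face_is_hull by blast
  \<comment> \<open>Dimensions in \<open>simplex\<close> are integers, so the empty face is covered
    as a simplex of dimension -1.\<close>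
  have "(int (card (v ` A)) - 1) simplex F"
    unfolding simplex_def using A affine_independent by force
  then show "\<exists>k. k simplex F" by blast
qed

text \<open>The isomorphism is the inverse of \<open>v\<close>. Injectivity makes an index set
  recoverable from its image, so nonfaces are preserved as well as faces.\<close>

lemma boundary_complex_isomorphic: "simplicial_complex_isomorphic (boundary_complex P) K"
proof -
  have UK: "\<Union>K = I" using face_subset vertex_face by blast
  have UB: "\<Union>(boundary_complex P) = v ` I"
    unfolding boundary_complex_P using UK by blast
  have bij: "bij_betw (inv_into I v) (v ` I) I"
    using inj_on_index by (simp add: bij_betw_imageI bij_betw_inv_into)
  have "A \<in> (`) v ` K \<longleftrightarrow> inv_into I v ` A \<in> K" if A: "A \<subseteq> v ` I" for A
  proof -
    obtain S where S: "S \<subseteq> I" "A = v ` S" using A by (auto simp: subset_image_iff)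
    have inv: "inv_into I v ` A = S"
      using S inj_on_index by simp
    have "v ` S \<in> (`) v ` K \<longleftrightarrow> S \<in> K"
    proof
      assume "v ` S \<in> (`) v ` K"
      then obtain T where T: "T \<in> K" "v ` S = v ` T" by blast
      then have "S = T"
        using inj_on_image_eq_iff[OF inj_on_index S(1) face_subset] by simp
      then show "S \<in> K" using T(1) by simp
    qed simp
    then show ?thesis using S inv by simp
  qed
  then show ?thesis
    unfolding simplicial_complex_isomorphic_def UB UK unfolding boundary_complex_P
    using bij by blast
qed

text \<open>The vertices of such a face are affinely independent and span a hyperplane; a vertex
  outside the face lies off it and raises the dimension by one.\<close>

lemma aff_dim_P:
  assumes "A \<in> K" "card A = DIM('a)"
  shows "aff_dim P = DIM('a)"
proof -
  obtain i where i: "i \<in> I - A"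
    using proper_index[OF assms(1)] by blast
  have "card (v ` A) = DIM('a)"
    using assms card_image inj_on_subset[OF inj_on_index face_subset] by metis
  then have "aff_dim (v ` A) = int DIM('a) - 1"
    using aff_dim_affine_independent[OF affine_independent[OF assms(1)]] by simp
  then have "aff_dim (insert (v i) (v ` A)) = DIM('a)"
    using not_in_affine_hull[OF assms(1) i] by (simp add: aff_dim_insert)
  moreover have "insert (v i) (v ` A) \<subseteq> P"
    using i face_subset[OF assms(1)] vertex_in_P by auto
  ultimately show ?thesis
    using aff_dim_subset[of "insert (v i) (v ` A)" P] aff_dim_le_DIM[of P] by simp
qed

end


section \<open>Entries of vectors written as lists\<close>

text \<open>Two equal indices would make a positive multiple of \<open>1\<close> below
  \<open>CARD('n)\<close> vanish, so the map is injective, and counting makes it surjective. The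
  enumeration starts at \<open>1\<close> because \<open>vector\<close> does.\<close>

lemma bij_betw_one_plus_of_nat:
  assumes "\<And>j. 0 < j \<Longrightarrow> j < CARD('n) \<Longrightarrow> of_nat j \<noteq> (0 :: 'n::{finite, comm_ring_1})"
  shows "bij_betw (\<lambda>k. 1 + of_nat k :: 'n) {..<CARD('n)} UNIV"
proof -
  have less: "(of_nat i :: 'n) \<noteq> of_nat j" if "i < j" "j < CARD('n)" for i j
  proof
    assume "(of_nat i :: 'n) = of_nat j"
    then have "of_nat (j - i) = (0 :: 'n)" using that(1) by (simp add: of_nat_diff)
    then show False using assms[of "j - i"] that(1) less_imp_diff_less[OF that(2), of i] by simp
  qed
  have inj: "inj_on (\<lambda>k. 1 + of_nat k :: 'n) {..<CARD('n)}"
  proof (rule inj_onI)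
    fix i j assume "i \<in> {..<CARD('n)}" "j \<in> {..<CARD('n)}" "(1 + of_nat i :: 'n) = 1 + of_nat j"
    then show "i = j" using less[of i j] less[of j i] by (cases i j rule: linorder_cases) auto
  qed
  then have "card ((\<lambda>k. 1 + of_nat k :: 'n) ` {..<CARD('n)}) = CARD('n)"
    by (simp add: card_image)
  then have "(\<lambda>k. 1 + of_nat k :: 'n) ` {..<CARD('n)} = UNIV"
    by (intro card_subset_eq) auto
  with inj show ?thesis by (rule bij_betw_imageI)
qed

text \<open>\<open>vector\<close> writes the entries to consecutive indices, earlier entries over
  later ones. As the index type is finite, indices wrap around; the second assumption keeps entry
  \<open>k\<close> from being overwritten.\<close>

lemma vector_nth:
  assumes "k < length xs"
    and "\<And>j. 0 < j \<Longrightarrow> j \<le> k \<Longrightarrow> of_nat j \<noteq> (0 :: 'n::{finite, comm_ring_1})"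
  shows "(vector xs :: ('a::zero, 'n) vec) $ (1 + of_nat k) = xs ! k"
proof -
  define F where "F = (\<lambda>(x::'a) f (n::'n). (f (n + 1))(n := x))"
  have F: "F x f n i = (if i = n then x else f (n + 1) i)" for x f n i by (simp add: F_def)
  \<comment> \<open>The start index \<open>m\<close> is arbitrary because the tail of the list is
    written from \<open>m + 1\<close> on.\<close>
  have "foldr F xs (\<lambda>n x. 0) m (m + of_nat k) = xs ! k" for m
    using assms
  proof (induction xs arbitrary: m k)
    case (Cons x xs)
    show ?case
    proof (cases k)
      case (Suc l)
      \<comment> \<open>The head of the list is stored at \<open>m\<close>, so entry
        \<open>k\<close> survives only at a different index.\<close>
      have "m + of_nat k \<noteq> m" using Cons.prems(2)[of k] Suc by simp
      moreover have "foldr F xs (\<lambda>n x. 0) (m + 1) ((m + 1) + of_nat l) = xs ! l"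
        using Suc Cons.prems by (intro Cons.IH) auto
      moreover have "(m + 1) + of_nat l = m + of_nat k" using Suc by (simp add: algebra_simps)
      ultimately show ?thesis
        using Suc F[of x "foldr F xs (\<lambda>n x. 0)" m "m + of_nat k"] by simp
    qed (simp add: F)
  qed simp
  then show ?thesis unfolding vector_def F_def by simp
qed

lemma of_nat_neq_0_5:
  assumes "0 < j" "j < CARD(5)"
  shows "of_nat j \<noteq> (0 :: 5)"
proof -
  have "j = 1 \<or> j = 2 \<or> j = 3 \<or> j = 4" using assms by auto
  then show ?thesis by auto
qed

lemma of_nat_neq_0_12:
  assumes "0 < j" "j < CARD(12)"
  shows "of_nat j \<noteq> (0 :: 12)"
proof -
  have "j = 1 \<or> j = 2 \<or> j = 3 \<or> j = 4 \<or> j = 5 \<or> j = 6 \<or> j = 7 \<or> j = 8 \<or> j = 9 \<or> j = 10 \<or> j = 11"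
    using assms by simp arith
  then show ?thesis by auto
qed

lemma inner_vector_5:
  assumes "length xs = 5" "length ys = 5"
  shows "(vector xs :: real^5) \<bullet> vector ys = (\<Sum>k<5. xs ! k * ys ! k)"
proof -
  have "(vector xs :: real^5) \<bullet> vector ys = (\<Sum>i\<in>UNIV. (vector xs :: real^5) $ i * (vector ys :: real^5) $ i)"
    by (simp add: inner_vec_def)
  also have "\<dots> = (\<Sum>k<CARD(5). (vector xs :: real^5) $ (1 + of_nat k) * (vector ys :: real^5) $ (1 + of_nat k))"
    by (rule sum.reindex_bij_betw[symmetric]) (rule bij_betw_one_plus_of_nat[OF of_nat_neq_0_5])
  also have "\<dots> = (\<Sum>k<5. xs ! k * ys ! k)"
    using assms of_nat_neq_0_5 by (intro sum.cong) (auto simp: vector_nth)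
  finally show ?thesis .
qed

lemma rows_vector_12:
  assumes "length xs = 12"
  shows "rows (vector xs :: real^'m^12) = set xs"
proof -
  have "rows (vector xs :: real^'m^12) = range (($) (vector xs :: real^'m^12))"
    by (simp add: rows_def row_def full_SetCompr_eq)
  also have "\<dots> = (\<lambda>k. (vector xs :: real^'m^12) $ (1 + of_nat k)) ` {..<CARD(12)}"
    using bij_betw_imp_surj_on[OF bij_betw_one_plus_of_nat[OF of_nat_neq_0_12]]
    by (metis image_image)
  also have "\<dots> = (!) xs ` {..<12}"
    using assms of_nat_neq_0_12 by (intro image_cong) (auto simp: vector_nth)
  also have "\<dots> = set xs" using assms by (simp add: set_conv_nth) blast
  finally show ?thesis .
qed

section \<open>Integer coordinates and certificate tables\<close>

text \<open>All coordinates are scaled by \<open>10^7\<close>.\<close>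

definition bier_points :: "((nat + nat) \<times> int list) list" where
  "bier_points =
    [(Inl 1, [34083657, 25824889, 27636015, 42308106, 18312304]),
     (Inl 2, [47537197, 57195211, 43242208, 50848353, 47010916]),
     (Inl 3, [-36225148, -36600717, -22568660, -30205762, -32792018]),
     (Inl 4, [-5413665, -13194438, 1968267, 26400609, -24040568]),
     (Inl 5, [12000480, 20558616, 1089153, -20769712, 40182034]),
     (Inl 6, [-38440022, -37596347, -43286914, -62082317, -29269678]),
     (Inr 1, [-20189640, -6272048, -8564941, -23165986, -1697324]),
     (Inr 2, [-43439331, -48032114, -30078281, -31808993, -40042503]),
     (Inr 3, [-15662252, -13174413, -29671459, -46607583, -1247618]),
     (Inr 4, [1168746, -1838719, -1546464, -16760483, 2340882]),
     (Inr 5, [12326930, 4628524, 17251772, 44773757, -15127640]),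
     (Inr 6, [52253047, 48501556, 44529303, 67070012, 36371211])]"

text \<open>
  Each pair of lists is a facet of the Bier sphere.  Its certificate is the primitive integral affine
  functional (constant term first) vanishing on the five points of the facet.
\<close>

definition facet_table :: "((nat list \<times> nat list) \<times> int list) list" where
  "facet_table =
    [(([1, 2, 3], [4, 5]),
      [1022039730770842912117787733385532584, 36416717808122925348977999422, 109406573593035887327234571766,
       -318433964032157338013141403580, 82563674820376610163026449836, 11930002468993340008004839093]),
     (([1, 2, 3], [4, 6]),
      [54338236421741755531935957014606399, 2463771715148272541689175144, 8182534801416309083451623849,
       -17382668650184499814787916548, 3868933072879083325648730730, -1797981208160141876774263957]),
     (([1, 2, 3], [5, 6]),
      [382907987699036277546621979384484495, 15160879146710336086418009813, 42473473787169439679449477907,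
       -118016266245639107225600343659, 29032550786812470810417507915, 2002376638002852056161557809]),
     (([1, 2, 6], [3, 4]),
      [130641047511872397239343892205139559, -20839231687258580502984093896, -20209084607871874337329324633,
       4927799957632205787588573758, 11693250679846881034210034608, 25700179587255820006106244033]),
     (([1, 2, 6], [3, 5]),
      [88699190685072171772731007268390952, -14148867467674474707512741170, -13721029605571518527804505002,
       3345750228447709160693294836, 7939170974094300192818962092, 17449225991850191855767627481]),
     (([1, 2, 6], [4, 5]),
      [392084917557322642524024835464699082, -62543499475554819248557292174, -60652287246701212547388091814,
       14789497090685001382767356666, 35094234854169562082963116626, 77132373962862057039558791959]),
     (([1, 2], [3, 4, 6]),
      [100903429806437005644980797238377523, -16095553001858226899378818168, -15608548394848704980154283229,
       3806035161688262656606529782, 9031449693914969011949457680, 19849699517851430627279947581]),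
     (([1, 2], [3, 5, 6]),
      [64677556298283228880867171248657477, -10317037112150057353220620747, -10005069439597616801159516237,
       2439678581934669445980939823, 5789047775916660261752861445, 12723574530836696118725046245]),
     (([1, 3, 5], [2, 4]),
      [616933750675957016289982299659085499, 37482821902953895649415288467, 163923717612601930224960068321,
       -203933582575866076836820853137, 27598712951321936113087891624, -90624037999742823590521481769]),
     (([1, 3, 5], [2, 6]),
      [525486096804148725790548634130156869, 31926835339586405749279442285, 139625407666223500311454865823,
       -173704664665266137916563584099, 23507749900046128166671946838, -77190926521722076853766020701]),
     (([1, 3, 5], [4, 6]),
      [502701259442142463720041775867255367, 30542500798416818137077373151, 133571277216306668121304649113,
       -166172967911543499039959107777, 22488507563927676968706488456, -73843920255773126703941477703]),
     (([1, 3], [2, 4, 5]),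
      [394332187132391050682771105913317128, -23457682110005836163242871807, 63148036658531523551344821648,
       -80146287064608339115959698523, 22609025307601944531598672178, 1790016094462662495870597194]),
     (([1, 3], [2, 5, 6]),
      [409895061670612224450789377305232720, 17508784554382205229643808525, 66853841052100536771939032520,
       -99223366794982135134614624271, 9834459820332102135101079586, -22230430902519751441422391694]),
     (([1, 4, 5], [2, 3]),
      [740679718873074744953957536444073057, -83257023925993169461161529544, 174316256454255210662396288778,
       136195924755874509311083003759, -88569385566938251886940885618, -132227136079475864253683661392]),
     (([1, 4, 5], [2, 6]),
      [57668610670896484966591193947357613, -3706818075052380894138192902, 13390622063515297533932681364,
       7295950142463488494919281315, -6638109827286131618535265596, -10808206145690577346476557336]),
     (([1, 4, 5], [3, 6]),
      [519594948682634682094564988075719069, -49946721005433881062642330972, 104327108955435580240650077970,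
       105197492289172119791073692831, -66160854629937251279675296626, -88441250989265468167239969526]),
     (([1, 4, 6], [2, 3]),
      [201298441928116751918745321706776176, -40649496504477288936941009089, 36971186796058372283737101009,
       18850489458488197568072419646, -4312650285685965966155545909, -5956873862386543373026798760]),
     (([1, 4, 6], [2, 5]),
      [704810262307464841702601251528593302, -147309322786579672018849021735, 108313848674216280139751030658,
       -1516592795385161458340265919, 24148451745784749299857489652, 29437823570631982312913137126]),
     (([1, 4, 6], [3, 5]),
      [593647731558048716955313462966463102, -107709016160668819228938549520, 49256552676928439732166274818,
       71159536106150539050637447316, -10720182139264558609313325478, 15967899000038892399175290241]),
     (([1, 4], [2, 5, 6]),
      [245170348814152888869739577480380144, 8069712818182976373324774727, 39803042353347259509300099480,
       -50670720705780118352430413133, 2799639412553594010379724966, -14538611131479786633166586026]),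
     (([1, 4], [3, 5, 6]),
      [710524107861815887695116162730549849, -88181841394394668039254907927, 21691354335554431336732620399,
       129226788633457047444878335931, -43529891240552434449728895271, 284644333967325349627306185]),
     (([1, 5], [2, 3, 4]),
      [2471109170567388612665164107844456756, -482013726460891307170257363677, 682370953379802822371522118899,
       51556352074259157799103042072, -3483720719413472040071246069, -269867476546823047517546406786]),
     (([1, 5], [3, 4, 6]),
      [938187348141825659386521000644892518, -126560235750913351082431618171, 4838527820196321235864175647,
       15446529362676394675394763352, 50450780457541106603220431339, 37632424003348653483561767133]),
     (([1, 6], [2, 3, 4]),
      [517043301504699246673045790219936551, -113082096867457591341655310672, 114380176109918619951234507839,
       17680372182886310875815702542, 6034081660263095994599892496, -19689103469421230911092701331]),
     (([1, 6], [2, 4, 5]),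
      [60906672436357711854482482592336127, -12729839101095874301948109908, 9360017154404120159511331042,
       -131062956265253973844910537, 2086808536693827086169980137, 2543892573711298403457359081]),
     (([2, 3, 4], [1, 5]),
      [82566986304131058416250393492065453, 9822864728511506419149171765, 8610791048121264402928556551,
       -18037258426643161315142613193, -272445935646921246126529003, -5279415213651541456652427176]),
     (([2, 3, 4], [1, 6]),
      [52029957056723983796740508624352882, 6189927419930697634603392383, 5426157861553132886581801422,
       -11366263961639917191820188116, -171691717009830429863054395, -3326874307207335085326105657]),
     (([2, 3, 4], [5, 6]),
      [565677177616367151252638254451549887, 67297654121624292221238284889, 58993835656886572534423636063,
       -123575735521373775644096868397, -1866534215573457851961454645, -36170025861239199748795498297]),
     (([2, 3], [1, 4, 5]),
      [625442046034097347412051275755728600, 27427115495541473250405761154, -11178462435772902190869170678,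
       -168290822596690440427539211828, 64089579752031332866299010964, 58040167937728474846894917547]),
     (([2, 3], [1, 4, 6]),
      [286778828343696416290690784759775425, 20277842641510404323350612742, 71813442571780395889168856369,
       -96759053998485391604064296815, 13974765941106124874396826270, -40089291645317945561303558378]),
     (([2, 4, 5], [1, 3]),
      [404850901786951962982509038683346761, 83664588605197536006259284563, -53250546587437062569312270149,
       127748533317761560718538046751, -84236721623138887734522076521, -54820986195373561421307666208]),
     (([2, 4, 5], [1, 6]),
      [283784621605609089197460283522861564, 51805863706960115790830935063, 23558350735273405348164465100,
       12551255903830550980429487926, -39850279740974635270913755815, -55526208818210047432695394393]),
     (([2, 4, 5], [3, 6]),
      [1641668367935331589201390455896496557, 221781609422840952058177892783, -136821536350098131255178719947,
       511457936428731697626227926169, -320438784458760773262421738395, -216583608547639387468195232063]),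
     (([2, 4], [1, 3, 5]),
      [686203793310997191401168605071751367, 108628054452891971750119872651, -197266615037562489016072317603,
       177696315077450276972214135537, -80185490073298802120642943297, 38840930903723760476649591979]),
     (([2, 4], [3, 5, 6]),
      [534544106780136460923569847868100193, 31297748268780612816922813337, -88410901014115505745641185105,
       143835367771733295349614420491, -65715380081901108421794119855, 3320266282511272943511803985]),
     (([2, 5, 6], [1, 3]),
      [174389138659080269803739839512844542, 550651260436237904955019866, -23421194280416056247298891473,
       -9277627303565004796382852228, 15659745963171416809222426543, 15824567034967482133774711519]),
     (([2, 5, 6], [1, 4]),
      [296895047535966461657962030410795791, 401803789896724165300368260, -39582549572015714590384502402,
       -17082457504704313283082995627, 27489614561860198742088787739, 27415295560970180086485979710]),
     (([2, 5, 6], [3, 4]),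
      [216750487022339506370793199237886086, -173852082483938773306507214, -28726439980647208494653646252,
       -12074845537283801347042356552, 19980451739718947980640465552, 20010217813537550555614922569]),
     (([2, 5], [1, 4, 6]),
      [210750293832688935884545660214138041, 14901940451337968001046178284, 52774864892789098717819273422,
       -71107041960530070452351646309, 10269875033461012406119929305, -29461179570190016884674155114]),
     (([2, 5], [3, 4, 6]),
      [919103005890545162941082392451095358, -114608516364960243047181441718, -17981426216026881057313046659,
       11836426022325660169036786718, 54485562021998210031607371465, 48396882838932669635355929278]),
     (([2, 6], [1, 3, 5]),
      [98993220673379098997151814887759912, 14456957574533594572902506466, -29177914142819355003368028518,
       23575633531405926464769957772, -9698251789936274588494730012, 7578626560361944662652681759]),
     (([2, 6], [1, 4, 5]),
      [646486288583538172519945094024294142, 3554865236016232865167026894, -164546456125646136665620726234,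
       -79188289296385972410214149778, 86779563019083281511057402470, 161823549303537999580094775833]),
     (([3, 4, 6], [1, 2]),
      [356188707035382664246552475967441157, 35468091622365941684714376066, -47959709545989649465496892347,
       20116818391762564182723251609, -11604392866116906264126759448, 22054802779614569149014280868]),
     (([3, 4, 6], [1, 5]),
      [1245663677001969200951921006547719176, 118016936205691603188889226520, -190788392876383033722503641286,
       52987101172836188554329291620, -24857681718701744131778684536, 106991647116961770727461890195]),
     (([3, 4, 6], [2, 5]),
      [249414550418697684918232542902090554, 4869969069653401385164696299, -17616238550974635899257882058,
       3352882620049956357930246371, 178168705524777073362601988, 19416748689789310445182157954]),
     (([3, 4], [1, 2, 6]),
      [15160505841403624949530001541074087, 1833982949409280158663986816, 1719488850896653269619943747,
       -3268844332567909363188604969, -118559410842142745397732018, -1123923177443291452020123668]),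
     (([3, 4], [2, 5, 6]),
      [43662880998075026465030428017540144, 3890792637151229515270659619, 5700713997235514597633207480,
       -9773012515351148871790206785, 190933997933950577359499838, -2779194256827712055038096338]),
     (([3, 5, 6], [1, 2]),
      [733277682997054585635661465625789977, 18633982321815345441624371851, 32601277171182458414968873183,
       -48505282348965593623220513051, 26391212216008419789193655322, -25537881004198544030949632827]),
     (([3, 5, 6], [1, 4]),
      [594400153152350120989125212656276714, 5090403551769839346012420487, 24870579356734427795159291506,
       -60947701681138130000474681762, 37604339606768748160949981934, -7948314765450309709973843164]),
     (([3, 5, 6], [2, 4]),
      [153342792853891813132237306971421156, -2060669407211976385781112929, 12374713576630881306596322442,
       -13893899010992420083894430726, 8246366610413072023352858514, -4893070222472022272594782543]),
     (([3, 5], [1, 2, 6]),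
      [432684316660710639665502132403517129, 33780126850403410067643805355, 109094125661605310403956564303,
       -139569170878172604040602130819, 16035725359702409995492861038, -64601426400105566750276160671]),
     (([3, 5], [1, 4, 6]),
      [698764280250889903350060318526007389, 49408931514212252846185343245, 174980614490273447766086413939,
       -235762777426172593263155176331, 34050810766363714779933715656, -97681644641289425649905306197]),
     (([3, 6], [1, 4, 5]),
      [474543950904194428565702164661192456, 4244670192887817703430340276, -89675680671658232393766915946,
       -69850130305965104022694371236, 59320416125090932751125343280, 103305012384932852590552299405]),
     (([3, 6], [2, 4, 5]),
      [129997347781675223922842718656668728, -15833372538829338003089691907, 7522737766716470617869764706,
       -9519343034087703629673476658, 8367556986000694163450181822, 11902786732863517980693538871]),
     (([4, 5], [1, 2, 3]),
      [212219257319674896371778071173144255, 39764834318666915177374381705, -12492163491164961166394174927,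
       57250932436540090824306394561, -40830919734373442842114923963, -33422803644887137051486743268]),
     (([4, 5], [1, 2, 6]),
      [534936235705611103717510712062066138, 96919099370534185575550330864, 49467969084180116497578253321,
       17952421206346263631533821854, -73631367966214880205417338046, -106113597192708420907619113912]),
     (([4, 6], [1, 2, 3]),
      [296217370557965930804686535875863692, 43373821751794975129065568061, -36250238616914291604864921709,
       62219342816477619369553966850, -37226514151554420124707683571, -13337072966856643105253603840]),
     (([4, 6], [1, 3, 5]),
      [915407369048097447952192059958489612, 139782547508564063462349587556, -259492082389505757382677273838,
       227569113350443246692052048992, -100395000510005698405238545492, 57400944044951366799040175039]),
     (([5, 6], [1, 2, 3]),
      [44891262473167393807396642644790710, 3180380122254632599936819320, 62525290288126125585689857,
       2218782735212366702767739224, -1457809716804619531849458407, -2912686445819095279827748067]),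
     (([5, 6], [2, 3, 4]),
      [188416707742643166398768046693487228, -18633325780808239674063010931, 30052689210834395617630910622,
       -5369970331360655453884971234, 5535669787827851949091871558, -11493359572411362722929433453])]"

text \<open>
  The minimal nonfaces are the six pairs \<open>{i, i}\<close> with one bar and the ten missing triangles in
  each of the two copies of the vertex set.  The coefficients were found by rounding, in a reduced
  basis of the lattice of integral affine dependences of the twelve points, the dependence that
  expresses the barycentre of the nonface by all twelve points with positive weights.
\<close>

definition nonface_table :: "((nat list \<times> nat list) \<times> int list) list" where
  "nonface_table =
    [(([1], [1]),
      [-133541465, 809915, 42255565, 844446, 5393274, 1014087,
       -47773079, 731855, 59568, 32897104, 808927, 96499803]),
     (([2], [2]),
      [1791384, -535849989, 963686, 10962037, 2266047, 1988803,
       393811504, -283804113, 563994, 1102440, 1000620, 405203587]),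
     (([3], [3]),
      [477409, 217313, -15859523, 533448, 4619289, 15685098,
       2073683, 6697334, -16382815, 810948, 861664, 266152]),
     (([4], [4]),
      [12219138659464, 1279433, 648575, -35184371336005, 550698, 3169024517153,
       640900, 16208588243555, 1350587, -15659712005766, 19247326722445, 728961]),
     (([5], [5]),
      [392322, 1502130, 163175, 2515276, -4927023, 1045087,
       633518, 1086786, 826811, 744743, -7870605, 3887780]),
     (([6], [6]),
      [2302088232146, 1076187544556, 528687, 1592954, 762277, -3206960598086,
       256092, 644978, 2686371972301, 1001848, 1540354259111, -4398046196864]),
     (([1, 2, 4], []),
      [-21477191, -13757051, 6529604, -14917690, 1354593, 1304654,
       1154677, 748549, 38835, 527647, 9515350, 28978023]),
     (([1, 2, 5], []),
      [-178563920, -61541558, 762887, 228164, -6260266, 843637,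
       2484686, 1180947, 896264, 63383030, 943966, 175642163]),
     (([1, 3, 4], []),
      [-27610554, 747543, -52832800, -89071295, 873756, 358284,
       430929, 76976035, 673512, 376449, 69610236, 19467905]),
     (([1, 3, 6], []),
      [-17136078, 1496634, -21216164, 1432964, 1606896, -4052497,
       665030, 12712914, 539070, 14375523, 9166914, 408794]),
     (([1, 5, 6], []),
      [-5059178, 469866, 305405, 25046, -3880106, -10753148,
       264014, 1798905, 10442110, 4785129, 1196440, 405517]),
     (([2, 3, 5], []),
      [1431241, -11728123602962, -10611756791179, 769457, -2406659904105, 1185372,
       12448944657603, 610026, 211346, 3704780017650, 1199965, 8592810215586]),
     (([2, 3, 6], []),
      [1486493, -15960882, -21865103, 809353, 1611761, -4060156,
       18259996, 1081959, 783611, 7789257, 9068168, 995543]),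
     (([2, 4, 6], []),
      [1622162, -59673139, 1206024, -70486093, 1263036, -88283308,
       43818970, 115058, 78902081, 196162, 90460103, 858944]),
     (([3, 4, 5], []),
      [1280066, 366591, -10023152, -7873283, -5297700, 1246768,
       3908435, 10865925, 610886, 660427, 448154, 3806883]),
     (([4, 5, 6], []),
      [827268, 969397, 864081, -5986491, -7350711, -10938164,
       1825561, 5057523, 12445331, 1080881, 511137, 694187]),
     (([], [1, 2, 4]),
      [232106, 492624, 155488860, 30098, 34829390, 1109512,
       -56416373, -88321363, 447259, -54763801, 941303, 5930385]),
     (([], [1, 2, 5]),
      [784751, 2800243, 42335538, 48348242, 138223, 359807,
       -10310847, -44547255, 99969, 133998, -40158484, 15815]),
     (([], [1, 3, 4]),
      [1508553, 304210531, 1733034, 770286, 638437678, 1419706390,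
       -521422496, 1552439, -1430311757, -419421025, 1866180, 1370187]),
     (([], [1, 3, 6]),
      [280603, 8898545, 503817, 4014142, 3739901, 258728,
       -7488501, 935156, -1944407, 537256, 1514854, -11250094]),
     (([], [1, 5, 6]),
      [95040, 7039624060136, 3435040138093, 3761143568432, 427479, 536216,
       -5864061530749, 1062341, 952912, 1179703, -3236194129026, -5135556360577]),
     (([], [2, 3, 5]),
      [4339298, 1328347, 1665199, 23142667, 903392, 14381340,
       219328, -12487683, -13856095, 1102533, -21135229, 396903]),
     (([], [2, 3, 6]),
      [22100263, 1004276, 974003, 37827455, 21355352, 29435,
       774266, -30802392, -10659784, 1211219, 436501, -44250594]),
     (([], [2, 4, 6]),
      [8485940393617, 343033, 5606180882689, 1208466, 1545035506700, 19806,
       807226, -4778262202204, 606425, -4994835407764, 109294, -5864062267288]),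
     (([], [3, 4, 5]),
      [41909115001177, 8981733581307, 349227, 588424, 943420, 56468804695954,
       1173988, 1214108, -46912495899715, -29185070433404, -31262092414370, 1199884]),
     (([], [4, 5, 6]),
      [6269265488491, 2120682120513, 848778, 1074274, 635420, 35516837127,
       1592765, 816740, 1475744, -2228316143743, -333094330037, -5864060416072])]"

section \<open>Exact verification of the tables by evaluation on lists\<close>

definition affine_value :: "int list \<Rightarrow> int list \<Rightarrow> int" where
  "affine_value h p = sum_list (map2 (*) h (1 # p))"

definition point :: "int list \<Rightarrow> real^5" where
  "point p = vector (map (\<lambda>z. real_of_int z / 10^7) p)"

definition labelled_join :: "nat list \<times> nat list \<Rightarrow> (nat + nat) list" where
  "labelled_join T = map Inl (fst T) @ map Inr (snd T)"

text \<open>The strict sign ensures that the hyperplane contains no point of the configuration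
  besides those of the facet.\<close>

definition facet_certificate :: "nat list \<times> nat list \<Rightarrow> int list \<Rightarrow> bool" where
  "facet_certificate T h \<longleftrightarrow> length h = 6 \<and>
    (\<forall>(i, p)\<in>set bier_points.
       if i \<in> set (labelled_join T) then affine_value h p = 0 else 0 < affine_value h p)"

text \<open>Prefixing each point by \<open>1\<close> merges both conditions on an affine dependence:
  position 0 expresses that the coefficients sum to zero, positions 1 to 5 are the
  coordinates.\<close>

definition nonface_certificate :: "nat list \<times> nat list \<Rightarrow> int list \<Rightarrow> bool" where
  "nonface_certificate T c \<longleftrightarrow> length c = 12 \<and>
    (\<forall>j\<in>set [0..<6]. sum_list (map (\<lambda>(t, i, p). t * (1 # p) ! j) (zip c bier_points)) = 0) \<and>
    (\<forall>(t, i, p)\<in>set (zip c bier_points). 0 < t \<or> i \<in> set (labelled_join T))"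

definition triangles :: "nat list list" where
  "triangles =
    [[1,2,3], [1,2,6], [1,3,5], [1,4,5], [1,4,6], [2,3,4], [2,4,5], [2,5,6], [3,4,6], [3,5,6]]"

definition is_face :: "nat list \<Rightarrow> bool" where
  "is_face A \<longleftrightarrow> (\<exists>T\<in>set triangles. set A \<subseteq> set T)"

text \<open>Each of the 64 subsets of the vertex set occurs as one increasing list, so a claim about
  all subsets becomes a finite evaluation.\<close>

definition index_lists :: "nat list list" where
  "index_lists = subseqs [1, 2, 3, 4, 5, 6]"

lemma points_length: "\<forall>(i, p)\<in>set bier_points. length p = 5"
  by code_simp

lemma facet_table_valid: "\<forall>(T, h)\<in>set facet_table. facet_certificate T h"
  by code_simp

lemma nonface_table_valid: "\<forall>(T, c)\<in>set nonface_table. nonface_certificate T c"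
  by code_simp

text \<open>This is the closedness of the sphere: every ridge lies in a second facet. Crossing the
  ridge opposite to \<open>i\<close> gives a facet that avoids \<open>i\<close>.\<close>

lemma facet_neighbours:
  "\<forall>(T, h)\<in>set facet_table. \<forall>i\<in>set (labelled_join T). \<exists>(T', h')\<in>set facet_table.
     set (remove1 i (labelled_join T)) \<subseteq> set (labelled_join T') \<and> i \<notin> set (labelled_join T')"
  by code_simp

lemma self_dual_lists:
  "\<forall>A\<in>set index_lists.
     is_face A \<longleftrightarrow> \<not> is_face (filter (\<lambda>x. x \<notin> set A) [1, 2, 3, 4, 5, 6])"
  by code_simp

text \<open>Completeness of the list of facets. By self-duality both members of the pair range over
  the faces of the same complex.\<close>

lemma faces_in_facets:
  "\<forall>A\<in>set (filter is_face index_lists).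
   \<forall>B\<in>set (filter (\<lambda>B. \<forall>x\<in>set A. x \<notin> set B) (filter is_face index_lists)).
   \<exists>((T, U), h)\<in>set facet_table. set A \<subseteq> set T \<and> set B \<subseteq> set U"
  by code_simp

text \<open>A missing triangle needs one dependence in the unbarred and another in the barred copy
  of the vertex set, hence the conjunction.\<close>

lemma nonfaces_contain_minimal:
  "\<forall>A\<in>set index_lists. is_face A \<or>
     (\<exists>((T, U), c)\<in>set nonface_table. U = [] \<and> set T \<subseteq> set A) \<and>
     (\<exists>((T, U), c)\<in>set nonface_table. T = [] \<and> set U \<subseteq> set A)"
  by code_simp

lemma antipodal_nonfaces:
  "\<forall>i\<in>set [1, 2, 3, 4, 5, 6]. \<exists>((T, U), c)\<in>set nonface_table. T = [i] \<and> U = [i]"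
  by code_simp

section \<open>Faces and nonfaces of the Bier sphere\<close>

lemma is_face_iff: "is_face A \<longleftrightarrow> set A \<in> hemi_icosahedron"
  unfolding is_face_def triangles_def hemi_icosahedron_def simplicial_complex_generated_by_def
  by (simp only: list.set ball_simps bex_simps UN_iff Pow_iff)

lemma atLeastAtMost_1_6: "{1..6::nat} = set [1, 2, 3, 4, 5, 6]"
  by auto

lemma subset_listE:
  assumes "A \<subseteq> {1..6::nat}"
  obtains xs where "xs \<in> set index_lists" "A = set xs"
proof -
  have "A \<in> set ` set index_lists"
    using assms unfolding index_lists_def subseqs_powset atLeastAtMost_1_6 by blast
  then show ?thesis using that by blast
qed

lemma hemi_icosahedron_subset: "A \<in> hemi_icosahedron \<Longrightarrow> A \<subseteq> {1..6}"
  by (auto simp: hemi_icosahedron_def simplicial_complex_generated_by_def)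

lemma hemi_icosahedron_closed: "A \<in> hemi_icosahedron \<Longrightarrow> B \<subseteq> A \<Longrightarrow> B \<in> hemi_icosahedron"
  by (auto simp: hemi_icosahedron_def simplicial_complex_generated_by_def)

lemma hemi_icosahedron_empty: "{} \<in> hemi_icosahedron"
  by (simp add: hemi_icosahedron_def simplicial_complex_generated_by_def)

lemma hemi_icosahedron_vertex:
  assumes "i \<in> {1..6}"
  shows "{i} \<in> hemi_icosahedron"
proof -
  have "i = 1 \<or> i = 2 \<or> i = 3 \<or> i = 4 \<or> i = 5 \<or> i = 6" using assms by auto
  then show ?thesis
    by (auto simp: hemi_icosahedron_def simplicial_complex_generated_by_def)
qed

text \<open>All 15 edges are faces, no set of four vertices is one, and of two complementary
  triangles exactly one is a face. Hence a set is a face if and only if its complement is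
  not.\<close>

lemma alexander_dual_hemi_icosahedron: "alexander_dual 6 hemi_icosahedron = hemi_icosahedron"
proof -
  have "{1..6} - A \<notin> hemi_icosahedron \<longleftrightarrow> A \<in> hemi_icosahedron" if A: "A \<subseteq> {1..6}" for A
  proof -
    obtain xs where xs: "xs \<in> set index_lists" "A = set xs"
      using subset_listE[OF A] .
    have "{1..6} - A = set (filter (\<lambda>x. x \<notin> set xs) [1, 2, 3, 4, 5, 6])"
      by (simp only: xs(2) atLeastAtMost_1_6 set_filter set_diff_eq)
    moreover have "is_face xs \<longleftrightarrow> \<not> is_face (filter (\<lambda>x. x \<notin> set xs) [1, 2, 3, 4, 5, 6])"
      using self_dual_lists xs(1) by (rule bspec)
    ultimately show ?thesis unfolding is_face_iff xs(2) by argo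
  qed
  then show ?thesis
    unfolding alexander_dual_def using hemi_icosahedron_subset by blast
qed

text \<open>A disjoint union determines its two summands, which removes the existential quantifiers
  of \<open>deleted_join\<close>.\<close>

lemma Plus_mem_Bier_iff:
  "A <+> B \<in> Bier 6 hemi_icosahedron \<longleftrightarrow>
    A \<in> hemi_icosahedron \<and> B \<in> hemi_icosahedron \<and> A \<inter> B = {}"
proof -
  have "A <+> B = C <+> D \<longleftrightarrow> A = C \<and> B = D" for C D :: "nat set" by blast
  then show ?thesis
    by (simp add: Bier_def deleted_join_def alexander_dual_hemi_icosahedron)
qed

lemma Bier_face_in_facet:
  assumes "X \<in> Bier 6 hemi_icosahedron"
  obtains T h where "(T, h) \<in> set facet_table" "X \<subseteq> set (labelled_join T)"
proof -
  obtain A B where X: "X = A <+> B"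
    and AB: "A \<in> hemi_icosahedron" "B \<in> hemi_icosahedron" "A \<inter> B = {}"
    using assms unfolding Bier_def deleted_join_def alexander_dual_hemi_icosahedron by blast
  obtain xs where xs: "xs \<in> set index_lists" "A = set xs"
    using subset_listE[OF hemi_icosahedron_subset[OF AB(1)]] .
  obtain ys where ys: "ys \<in> set index_lists" "B = set ys"
    using subset_listE[OF hemi_icosahedron_subset[OF AB(2)]] .
  have xs': "xs \<in> set (filter is_face index_lists)"
    using xs AB(1) is_face_iff by simp
  have ys': "ys \<in> set (filter (\<lambda>B. \<forall>x\<in>set xs. x \<notin> set B)
      (filter is_face index_lists))"
    using xs ys AB is_face_iff by auto
  obtain T U h where "((T, U), h) \<in> set facet_table" "set xs \<subseteq> set T" "set ys \<subseteq> set U"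
    using bspec[OF bspec[OF faces_in_facets xs'] ys'] by fast
  then show ?thesis
    using that[of "(T, U)" h] X xs ys unfolding labelled_join_def by auto
qed

text \<open>Start from any facet containing \<open>X\<close>. If it contains \<open>i\<close>, pass
  to the neighbour across the ridge opposite to \<open>i\<close>; this ridge still contains
  \<open>X\<close>.\<close>

lemma Bier_face_avoiding:
  assumes "X \<in> Bier 6 hemi_icosahedron" "i \<notin> X"
  obtains T h where "(T, h) \<in> set facet_table" "X \<subseteq> set (labelled_join T)"
    "i \<notin> set (labelled_join T)"
proof -
  obtain T h where T: "(T, h) \<in> set facet_table" "X \<subseteq> set (labelled_join T)"
    using Bier_face_in_facet[OF assms(1)] .
  show ?thesis
  proof (cases "i \<in> set (labelled_join T)")
    case True
    then obtain T' h' where T': "(T', h') \<in> set facet_table"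
      "set (remove1 i (labelled_join T)) \<subseteq> set (labelled_join T')" "i \<notin> set (labelled_join T')"
      using facet_neighbours T(1) by fast
    have "X \<subseteq> set (labelled_join T')"
    proof
      fix x assume x: "x \<in> X"
      then have "x \<in> set (remove1 i (labelled_join T))"
        using T(2) assms(2) in_set_remove1[of x i] by blast
      then show "x \<in> set (labelled_join T')" using T'(2) by blast
    qed
    then show ?thesis using that T' by blast
  qed (use that T in blast)
qed

text \<open>There are three ways to fail: the unbarred part is a nonface, the barred part is a
  nonface, or the two parts share an index. They correspond to the three families in
  \<open>nonface_table\<close>.\<close>

lemma Bier_nonface_contains:
  assumes "X \<subseteq> {1..6} <+> {1..6}" "X \<notin> Bier 6 hemi_icosahedron"
  obtains T c where "(T, c) \<in> set nonface_table" "set (labelled_join T) \<subseteq> X"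
proof -
  define A B where "A = Inl -` X" and "B = Inr -` X"
  have X: "X = A <+> B"
  proof (rule set_eqI)
    fix x show "x \<in> X \<longleftrightarrow> x \<in> A <+> B"
      by (cases x) (auto simp: A_def B_def)
  qed
  have sub: "A \<subseteq> {1..6}" "B \<subseteq> {1..6}" using assms(1) unfolding X by auto
  obtain xs where xs: "xs \<in> set index_lists" "A = set xs"
    using subset_listE[OF sub(1)] .
  obtain ys where ys: "ys \<in> set index_lists" "B = set ys"
    using subset_listE[OF sub(2)] .
  consider "A \<notin> hemi_icosahedron" | "B \<notin> hemi_icosahedron" | "A \<inter> B \<noteq> {}"
    using assms(2) unfolding X Plus_mem_Bier_iff by blast
  then show ?thesis
  proof cases
    case 1
    then obtain T c where "((T, []), c) \<in> set nonface_table" "set T \<subseteq> A"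
      using nonfaces_contain_minimal xs is_face_iff by fast
    then show ?thesis using that[of "(T, [])" c] unfolding X labelled_join_def by auto
  next
    case 2
    then obtain U c where "(([], U), c) \<in> set nonface_table" "set U \<subseteq> B"
      using nonfaces_contain_minimal ys is_face_iff by fast
    then show ?thesis using that[of "([], U)" c] unfolding X labelled_join_def by auto
  next
    case 3
    then obtain i where i: "i \<in> A" "i \<in> B" by blast
    then have "i \<in> {1..6}" using sub by blast
    then have "i \<in> set [1, 2, 3, 4, 5, 6]" by auto
    then obtain c where "(([i], [i]), c) \<in> set nonface_table"
      using antipodal_nonfaces by fast
    then show ?thesis using that[of "([i], [i])" c] i unfolding X labelled_join_def by auto
  qed
qed

section \<open>The certificates in real coordinates\<close>

text \<open>Off the twelve labels the value is unspecified; every use stays within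
  \<open>{1..6} <+> {1..6}\<close>.\<close>

definition bier_vertex :: "nat + nat \<Rightarrow> real^5" where
  "bier_vertex i = point (the (map_of bier_points i))"

lemma labels: "set (map fst bier_points) = {1..6} <+> {1..6}" "distinct (map fst bier_points)"
proof -
  show "set (map fst bier_points) = {1..6} <+> {1..6}"
    unfolding atLeastAtMost_1_6 bier_points_def Plus_def
    by (simp only: list.map list.set fst_conv image_insert image_empty Un_insert_left Un_empty_left)
qed (simp add: bier_points_def)

lemma bier_vertex_eq: "(i, p) \<in> set bier_points \<Longrightarrow> bier_vertex i = point p"
  unfolding bier_vertex_def using labels(2) by simp

lemma label_point:
  assumes "i \<in> {1..6} <+> {1..6}"
  obtains p where "(i, p) \<in> set bier_points"
  using assms unfolding labels(1)[symmetric] by auto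

text \<open>The functional is evaluated at integer points, while \<open>point\<close> divides by
  \<open>10^7\<close>. The factor therefore reappears at the linear part but not at the constant
  term.\<close>

lemma affine_value_eq:
  assumes "length h = 6" "length p = 5"
  shows "real_of_int (affine_value h p) =
    of_int (hd h) + 10^7 * (vector (map of_int (tl h)) \<bullet> point p)"
proof -
  obtain h0 h1 h2 h3 h4 h5 where h: "h = [h0, h1, h2, h3, h4, h5]"
    using assms(1) by (auto simp: length_Suc_conv numeral_eq_Suc)
  obtain p1 p2 p3 p4 p5 where p: "p = [p1, p2, p3, p4, p5]"
    using assms(2) by (auto simp: length_Suc_conv numeral_eq_Suc)
  show ?thesis
    unfolding h p affine_value_def point_def by (simp add: inner_vector_5 numeral_eq_Suc field_simps)
qed

lemma supporting_hyperplane: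
  assumes "(T, h) \<in> set facet_table"
  obtains a b where
    "\<forall>i\<in>{1..6} <+> {1..6}. b \<le> a \<bullet> bier_vertex i"
    "\<forall>i\<in>{1..6} <+> {1..6}. a \<bullet> bier_vertex i = b \<longleftrightarrow> i \<in> set (labelled_join T)"
proof -
  define a :: "real^5" where "a = vector (map of_int (tl h))"
  \<comment> \<open>With this scaling \<open>a \<bullet> point p - b\<close> is the integer value
    divided by \<open>10^7\<close>, so signs and zeros carry over.\<close>
  define b :: real where "b = - of_int (hd h) / 10^7"
  have cert: "facet_certificate T h" using facet_table_valid assms by blast
  have "b \<le> a \<bullet> bier_vertex i \<and> (a \<bullet> bier_vertex i = b \<longleftrightarrow> i \<in> set (labelled_join T))"
    if i: "i \<in> {1..6} <+> {1..6}" for i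
  proof -
    obtain p where p: "(i, p) \<in> set bier_points" using label_point[OF i] .
    have "if i \<in> set (labelled_join T) then affine_value h p = 0 else 0 < affine_value h p"
      using cert p unfolding facet_certificate_def by blast
    moreover have "real_of_int (affine_value h p) = 10^7 * (a \<bullet> bier_vertex i - b)"
      using affine_value_eq[of h p] cert points_length p bier_vertex_eq[OF p]
      unfolding facet_certificate_def a_def b_def by (auto simp: algebra_simps)
    ultimately have "if i \<in> set (labelled_join T) then 10^7 * (a \<bullet> bier_vertex i - b) = 0
        else 0 < 10^7 * (a \<bullet> bier_vertex i - b)"
      by (metis of_int_0 of_int_0_less_iff)
    then show ?thesis by (auto simp: zero_less_mult_iff split: if_splits)
  qed
  then show ?thesis using that by blast
qed

text \<open>The position \<open>j\<close> depends on \<open>k\<close> alone, so a single integer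
  identity settles coordinate \<open>k\<close> for all points at once.\<close>

lemma point_nth:
  obtains j where "j < 5" "\<And>p. length p = 5 \<Longrightarrow> point p $ k = real_of_int (p ! j) / 10^7"
proof -
  obtain j where j: "j < 5" "k = 1 + of_nat j"
    using bij_betw_imp_surj_on[OF bij_betw_one_plus_of_nat[OF of_nat_neq_0_5]] by auto
  have "point p $ k = real_of_int (p ! j) / 10^7" if "length p = 5" for p
    unfolding point_def j(2) using that j(1) of_nat_neq_0_5 by (subst vector_nth) auto
  then show ?thesis using that j(1) by blast
qed

text \<open>Sums over the label set are rewritten as list sums over the coefficients zipped with the
  points, where the integer identities of the certificate apply.\<close>

lemma affine_dependence:
  assumes "(T, c) \<in> set nonface_table"
  obtains w :: "nat + nat \<Rightarrow> real" where
    "(\<Sum>i\<in>{1..6} <+> {1..6}. w i *\<^sub>R bier_vertex i) = 0" "(\<Sum>i\<in>{1..6} <+> {1..6}. w i) = 0"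
    "\<forall>i\<in>({1..6} <+> {1..6}) - set (labelled_join T). 0 < w i"
proof -
  define D where "D = zip c bier_points"
  define w where "w i = real_of_int (the (map_of (map (\<lambda>(t, i, p). (i, t)) D) i))" for i
  have cert: "length c = 12"
    "\<And>j. j < 6 \<Longrightarrow> sum_list (map (\<lambda>(t, i, p). t * (1 # p) ! j) D) = 0"
    "\<And>t i p. (t, i, p) \<in> set D \<Longrightarrow> 0 < t \<or> i \<in> set (labelled_join T)"
    using nonface_table_valid assms unfolding nonface_certificate_def D_def by auto
  have len: "length c = length bier_points" using cert(1) by (simp add: bier_points_def)
  have "map (\<lambda>(t, i, p). i) (zip ts ps) = map fst ps" if "length ts = length ps"
    for ts :: "int list" and ps :: "((nat + nat) \<times> int list) list"
    using that by (induction ts ps rule: list_induct2) auto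
  \<comment> \<open>The labels in \<open>D\<close> are thus distinct, so \<open>w\<close> looks up
    the right coefficient and a sum over labels equals a list sum.\<close>
  then have labels_D: "map (\<lambda>(t, i, p). i) D = map fst bier_points"
    using len unfolding D_def by blast
  have w: "w i = of_int t" if "(t, i, p) \<in> set D" for t i p
  proof -
    have "map fst (map (\<lambda>(t, i, p). (i, t)) D) = map fst bier_points"
      unfolding labels_D[symmetric] by auto
    then have "map_of (map (\<lambda>(t, i, p). (i, t)) D) i = Some t"
      using that labels(2) by (intro map_of_is_SomeI) force+
    then show ?thesis unfolding w_def by simp
  qed
  have D_points: "(i, p) \<in> set bier_points" if "(t, i, p) \<in> set D" for t i p
    using that unfolding D_def by (rule set_zip_rightD)
  have sum_eq: "(\<Sum>i\<in>{1..6} <+> {1..6}. f i) = sum_list (map (\<lambda>(t, i, p). f i) D)"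
    for f :: "nat + nat \<Rightarrow> real"
  proof -
    have "(\<Sum>i\<in>{1..6} <+> {1..6}. f i) = sum_list (map f (map fst bier_points))"
      using labels by (metis sum_list_distinct_conv_sum_set)
    also have "\<dots> = sum_list (map (\<lambda>(t, i, p). f i) D)"
      unfolding labels_D[symmetric] by (simp add: comp_def case_prod_unfold)
    finally show ?thesis .
  qed
  have of_int_sum: "real_of_int (sum_list xs) = sum_list (map of_int xs)" for xs
    by (induction xs) auto
  \<comment> \<open>Position 0 of \<open>1 # p\<close> holds the constant 1, so this is the first
    identity of the certificate.\<close>
  have "(\<Sum>i\<in>{1..6} <+> {1..6}. w i) = sum_list (map (\<lambda>(t, i, p). real_of_int (t * (1 # p) ! 0)) D)"
    unfolding sum_eq using w by (intro arg_cong[where f = sum_list] map_cong) auto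
  also have "\<dots> = real_of_int (sum_list (map (\<lambda>(t, i, p). t * (1 # p) ! 0) D))"
    by (simp add: of_int_sum comp_def case_prod_unfold)
  finally have sum0: "(\<Sum>i\<in>{1..6} <+> {1..6}. w i) = 0" using cert(2)[of 0] by simp
  have "(\<Sum>i\<in>{1..6} <+> {1..6}. w i *\<^sub>R bier_vertex i) $ k = 0" for k
  proof -
    obtain j where j: "j < 5" "\<And>p. length p = 5 \<Longrightarrow> point p $ k = real_of_int (p ! j) / 10^7"
      using point_nth[of k] by blast
    have "(\<Sum>i\<in>{1..6} <+> {1..6}. w i *\<^sub>R bier_vertex i) $ k =
      (\<Sum>i\<in>{1..6} <+> {1..6}. w i * bier_vertex i $ k)"
      by (simp add: sum_component)
    \<comment> \<open>Coordinate \<open>j\<close> of \<open>p\<close> sits at position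
      \<open>Suc j\<close> behind the constant; the scale factor then leaves the sum.\<close>
    also have "\<dots> = sum_list (map (\<lambda>(t, i, p). real_of_int (t * (1 # p) ! Suc j) * (1 / 10^7)) D)"
      unfolding sum_eq
    proof (intro arg_cong[where f = sum_list] map_cong refl)
      fix x assume x: "x \<in> set D"
      obtain t i p where tip: "x = (t, i, p)" by (cases x)
      have "length p = 5" using D_points points_length x tip by fast
      then show "(case x of (t, i, p) \<Rightarrow> w i * bier_vertex i $ k) =
        (case x of (t, i, p) \<Rightarrow> real_of_int (t * (1 # p) ! Suc j) * (1 / 10^7))"
        using x w bier_vertex_eq[OF D_points] j(2) unfolding tip by auto
    qed
    also have "\<dots> = real_of_int (sum_list (map (\<lambda>(t, i, p). t * (1 # p) ! Suc j) D)) * (1 / 10^7)"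
      unfolding of_int_sum sum_list_mult_const[symmetric]
      by (simp add: comp_def case_prod_unfold)
    finally show ?thesis using cert(2)[of "Suc j"] j(1) by simp
  qed
  then have sumv: "(\<Sum>i\<in>{1..6} <+> {1..6}. w i *\<^sub>R bier_vertex i) = 0"
    by (simp add: vec_eq_iff)
  have "0 < w i" if i: "i \<in> {1..6} <+> {1..6}" "i \<notin> set (labelled_join T)" for i
  proof -
    have "i \<in> set (map (\<lambda>(t, i, p). i) D)" using i(1) labels labels_D by metis
    then obtain t p where "(t, i, p) \<in> set D" by auto
    then show ?thesis using w cert(3) i(2) by fastforce
  qed
  then show ?thesis using that sum0 sumv by blast
qed

section \<open>The Bier sphere as the boundary of the polytope\<close>

interpretation bier: simplicial_certificate bier_vertex "{1..6} <+> {1..6}" "Bier 6 hemi_icosahedron"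
proof
  show "finite ({1..6::nat} <+> {1..6::nat})" by simp
  show "A \<subseteq> {1..6} <+> {1..6}" if "A \<in> Bier 6 hemi_icosahedron" for A
    using that hemi_icosahedron_subset
    unfolding Bier_def deleted_join_def alexander_dual_hemi_icosahedron by blast
  show "B \<in> Bier 6 hemi_icosahedron" if A: "A \<in> Bier 6 hemi_icosahedron" and "B \<subseteq> A" for A B
  proof -
    obtain C D where CD: "A = C <+> D" using A unfolding Bier_def deleted_join_def by blast
    \<comment> \<open>Splitting \<open>B\<close> into its unbarred and barred parts reduces the
      claim to subsets of faces of \<open>hemi_icosahedron\<close>.\<close>
    have B: "B = Inl -` B <+> Inr -` B"
    proof (rule set_eqI)
      fix x show "x \<in> B \<longleftrightarrow> x \<in> Inl -` B <+> Inr -` B" by (cases x) auto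
    qed
    have sub: "Inl -` B \<subseteq> C" "Inr -` B \<subseteq> D" using \<open>B \<subseteq> A\<close> CD by auto
    have "C \<in> hemi_icosahedron" "D \<in> hemi_icosahedron" "C \<inter> D = {}"
      using A unfolding CD Plus_mem_Bier_iff by auto
    then have "Inl -` B \<in> hemi_icosahedron" "Inr -` B \<in> hemi_icosahedron"
      "Inl -` B \<inter> Inr -` B = {}"
      using sub hemi_icosahedron_closed by blast+
    then show ?thesis by (subst B) (simp only: Plus_mem_Bier_iff simp_thms)
  qed
  show "{i} \<in> Bier 6 hemi_icosahedron" if "i \<in> {1..6} <+> {1..6}" for i
  proof (cases i)
    case (Inl j)
    then have "{j} <+> {} \<in> Bier 6 hemi_icosahedron"
      unfolding Plus_mem_Bier_iff
      using that hemi_icosahedron_empty hemi_icosahedron_vertex[of j] by blast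
    then show ?thesis unfolding Inl by (simp add: Plus_def)
  next
    case (Inr j)
    then have "{} <+> {j} \<in> Bier 6 hemi_icosahedron"
      unfolding Plus_mem_Bier_iff
      using that hemi_icosahedron_empty hemi_icosahedron_vertex[of j] by blast
    then show ?thesis unfolding Inr by (simp add: Plus_def)
  qed
  show "{1..6} <+> {1..6} \<notin> Bier 6 hemi_icosahedron"
    unfolding Plus_mem_Bier_iff by simp
  show "\<exists>a b. (\<forall>j\<in>{1..6} <+> {1..6}. b \<le> a \<bullet> bier_vertex j) \<and>
      (\<forall>j\<in>A. a \<bullet> bier_vertex j = b) \<and> b < a \<bullet> bier_vertex i"
    if A: "A \<in> Bier 6 hemi_icosahedron" and i: "i \<in> ({1..6} <+> {1..6}) - A" for A i
  proof -
    \<comment> \<open>The functional of a facet containing \<open>A\<close> but not \<open>i\<close>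
      is constant on \<open>A\<close> and larger at \<open>i\<close>.\<close>
    obtain T h where T: "(T, h) \<in> set facet_table" "A \<subseteq> set (labelled_join T)"
      "i \<notin> set (labelled_join T)"
      using Bier_face_avoiding[OF A, of i] i by blast
    obtain a b where ab: "\<forall>i\<in>{1..6} <+> {1..6}. b \<le> a \<bullet> bier_vertex i"
      "\<forall>i\<in>{1..6} <+> {1..6}. a \<bullet> bier_vertex i = b \<longleftrightarrow> i \<in> set (labelled_join T)"
      by (rule supporting_hyperplane[OF T(1)]) (rule that)
    have "A \<subseteq> {1..6} <+> {1..6}"
      using A hemi_icosahedron_subset
      unfolding Bier_def deleted_join_def alexander_dual_hemi_icosahedron by blast
    then have "\<forall>j\<in>A. a \<bullet> bier_vertex j = b" using ab(2) T(2) by blast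
    moreover have "b < a \<bullet> bier_vertex i" using ab T(3) i by force
    ultimately show ?thesis using ab(1) by blast
  qed
  show "\<exists>c. (\<Sum>i\<in>{1..6} <+> {1..6}. c i *\<^sub>R bier_vertex i) = 0 \<and>
      (\<Sum>i\<in>{1..6} <+> {1..6}. c i) = (0::real) \<and> (\<forall>i\<in>({1..6} <+> {1..6}) - S. 0 < c i)"
    if S: "S \<subseteq> {1..6} <+> {1..6}" "S \<notin> Bier 6 hemi_icosahedron" for S
  proof -
    obtain T c where T: "(T, c) \<in> set nonface_table" "set (labelled_join T) \<subseteq> S"
      using Bier_nonface_contains[OF S] .
    obtain w :: "nat + nat \<Rightarrow> real" where
      w: "(\<Sum>i\<in>{1..6} <+> {1..6}. w i *\<^sub>R bier_vertex i) = 0"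
        "(\<Sum>i\<in>{1..6} <+> {1..6}. w i) = 0"
        "\<forall>i\<in>({1..6} <+> {1..6}) - set (labelled_join T). 0 < w i"
      using affine_dependence[OF T(1)] .
    \<comment> \<open>Passing from the minimal nonface to \<open>S\<close> only shrinks the set on
      which positivity is required.\<close>
    have "\<forall>i\<in>({1..6} <+> {1..6}) - S. 0 < w i"
      using w(3) T(2) by (meson DiffE DiffI subsetD)
    then show ?thesis using w(1,2) by (intro exI[of _ w] conjI)
  qed
qed

text \<open>This ties the scaled integers to the decimal entries of the matrix.\<close>

lemma rows_bier_matrix: "rows bier_matrix = bier_vertex ` ({1..6} <+> {1..6})"
proof -
  have "bier_vertex ` ({1..6} <+> {1..6}) = bier_vertex ` fst ` set bier_points"
    using labels(1) by simp
  also have "\<dots> = point ` snd ` set bier_points"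
    using bier_vertex_eq by (force simp: image_image intro!: image_cong)
  also have "\<dots> = rows bier_matrix"
    unfolding bier_matrix_def bier_points_def by (simp add: rows_vector_12 point_def)
  finally show ?thesis by simp
qed

theorem theorem4p2:
  shows "(\<exists>P :: (real ^ 5) set. polytope P \<and> aff_dim P = 5 \<and>
            simplicial_complex_isomorphic (boundary_complex P) (Bier 6 hemi_icosahedron)) \<and>
         (let P = convex hull (rows bier_matrix) in
            simplicial_polytope P \<and> aff_dim P = 5 \<and>
            card (rows bier_matrix) = 12 \<and> vertices_of P = rows bier_matrix \<and>
            simplicial_complex_isomorphic (boundary_complex P) (Bier 6 hemi_icosahedron))"
proof -
  have P: "bier.P = convex hull (rows bier_matrix)"
    unfolding bier.P_def rows_bier_matrix ..
  \<comment> \<open>Any facet would do for the dimension: it has five vertices, as many as the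
    ambient space has dimensions.\<close>
  have "{1, 2, 3} \<in> hemi_icosahedron" "{4, 5} \<in> hemi_icosahedron"
    unfolding hemi_icosahedron_def simplicial_complex_generated_by_def by auto
  then have "{1, 2, 3} <+> {4, 5} \<in> Bier 6 hemi_icosahedron"
    unfolding Plus_mem_Bier_iff by simp
  then have dim: "aff_dim bier.P = 5"
    using bier.aff_dim_P by (simp add: card_Plus)
  have "card (rows bier_matrix) = 12"
    unfolding rows_bier_matrix card_image[OF bier.inj_on_index] by (simp add: card_Plus)
  moreover have "vertices_of bier.P = rows bier_matrix"
    using bier.vertices_of_P rows_bier_matrix by simp
  ultimately show ?thesis
    using dim bier.polytope_P bier.simplicial_P bier.boundary_complex_isomorphic
    unfolding Let_def P by blast
qed

end
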